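(* Let $A\in\mathbb{R}^{n\times n}$ be a $P$-matrix, $q\in\mathbb{R}^n$, $\zeta:\mathbb{R}^n\to\mathbb{R}^n$, $\gamma>0$, and suppose that $\mathrm{ICP}(q,A,\zeta)$ has a unique solution $z^*$. Let $\Omega_1,\Omega_2\in\mathbb{R}^{n\times n}$ be positive diagonal matrices, $\phi\in\mathbb{R}^{n\times n}$ a diagonal matrix, and $A=(M+\phi)-(N+\phi)$ a splitting of $A$ such that $\Omega_2+M\Omega_1+\phi\Omega_1$ is nonsingular. Let $\Psi\in\mathbb{R}^{n\times n}$ be a nonnegative matrix such that $|\zeta(x)-\zeta(y)|\le\Psi|x-y|$ for all $x,y\in\mathbb{R}^n$. Put $$L=\left|(\Omega_2+M\Omega_1+\phi\Omega_1)^{-1}\right|\left(|N\Omega_1+\phi\Omega_1|+|\Omega_2-A\Omega_1|+2|A|\Psi|A^{-1}|\Omega_2\right).$$ If $\rho(L)<1$, then for any initial vector $x^{(0)}\in\mathbb{R}^n$ the sequence $\{z^{(k)}\}_{k=0}^{\infty}\subset\mathbb{R}^n$ generated by the new relaxation modulus-based iterative method converges to the unique solution $z^*$ of $\mathrm{ICP}(q,A,\zeta)$.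
   Context: The problem $\mathrm{ICP}(q,A,\zeta)$ is to find $z\in\mathbb{R}^n$ such that $Az+q\ge 0$, $z-\zeta(z)\ge 0$ and $(z-\zeta(z))^T(Az+q)=0$. Absolute values and inequalities of vectors and matrices are entrywise; $\rho(\cdot)$ is the spectral radius. A $P$-matrix is a real square matrix all of whose principal minors are positive. A splitting $A=(M+\phi)-(N+\phi)$ means $A=M-N$ with $M,N\in\mathbb{R}^{n\times n}$. New relaxation modulus-based iterative method: given $x^{(0)}\in\mathbb{R}^n$, for $k=0,1,2,\dots$ let $z^{(k)}$ be the solution of $$Az^{(k)}=\tfrac{1}{\gamma}\Omega_2\left(|x^{(k)}|-x^{(k)}\right)-q,$$ and set $$x^{(k+1)}=(\Omega_2+M\Omega_1+\phi\Omega_1)^{-1}\left[(N\Omega_1+\phi\Omega_1)x^{(k)}+(\Omega_2-A\Omega_1)|x^{(k)}|-\gamma A\zeta(z^{(k)})-\gamma q\right].$$ (The infinite sequence is considered, with no stopping test.) *)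

theory Defs
  imports
    "Jordan_Normal_Form.Spectral_Radius"
    "Jordan_Normal_Form.Gauss_Jordan_Elimination"
    "Jordan_Normal_Form.DL_Submatrix"
begin

abbreviation vabs :: "real vec \<Rightarrow> real vec" where
  "vabs v \<equiv> map_vec abs v"

abbreviation mabs :: "real mat \<Rightarrow> real mat" where
  "mabs A \<equiv> map_mat abs A"

text \<open>Meaningful for invertible matrices only: \<^const>\<open>mat_inverse\<close> is \<^const>\<open>None\<close> on singular ones.\<close>

definition mat_inv :: "real mat \<Rightarrow> real mat" where
  "mat_inv A = the (mat_inverse A)"

definition P_matrix :: "nat \<Rightarrow> real mat \<Rightarrow> bool" where
  "P_matrix n A \<longleftrightarrow> A \<in> carrier_mat n n \<and>
     (\<forall>I. I \<subseteq> {0..<n} \<and> I \<noteq> {} \<longrightarrow> det (submatrix A I I) > 0)"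

definition pos_diagonal_mat :: "real mat \<Rightarrow> bool" where
  "pos_diagonal_mat D \<longleftrightarrow> diagonal_mat D \<and> (\<forall>i<dim_row D. D $$ (i, i) > 0)"

text \<open>The order on vectors is entrywise, see \<open>less_eq_vec_def\<close>.\<close>

definition ICP_solution ::
  "nat \<Rightarrow> real vec \<Rightarrow> real mat \<Rightarrow> (real vec \<Rightarrow> real vec) \<Rightarrow> real vec \<Rightarrow> bool" where
  "ICP_solution n q A \<zeta> z \<longleftrightarrow> z \<in> carrier_vec n \<and>
     0\<^sub>v n \<le> A *\<^sub>v z + q \<and>
     0\<^sub>v n \<le> z - \<zeta> z \<and>
     (z - \<zeta> z) \<bullet> (A *\<^sub>v z + q) = 0"

text \<open>The vector \<open>z\<close> belonging to an iterate \<open>x\<close>; the description is unique for nonsingular \<open>A\<close>,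
  in particular for a \<open>P\<close>-matrix.\<close>

definition z_of ::
  "nat \<Rightarrow> real mat \<Rightarrow> real vec \<Rightarrow> real \<Rightarrow> real mat \<Rightarrow> real vec \<Rightarrow> real vec" where
  "z_of n A q \<gamma> \<Omega>2 x =
     (THE z. z \<in> carrier_vec n \<and> A *\<^sub>v z = ((1 / \<gamma>) \<cdot>\<^sub>m \<Omega>2) *\<^sub>v (vabs x - x) - q)"

primrec relaxation_x ::
  "nat \<Rightarrow> real mat \<Rightarrow> real mat \<Rightarrow> real mat \<Rightarrow> real mat \<Rightarrow> real mat \<Rightarrow> real mat \<Rightarrow>
   real vec \<Rightarrow> (real vec \<Rightarrow> real vec) \<Rightarrow> real \<Rightarrow> real vec \<Rightarrow> nat \<Rightarrow> real vec" where
  "relaxation_x n A M N \<phi> \<Omega>1 \<Omega>2 q \<zeta> \<gamma> x0 0 = x0"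
| "relaxation_x n A M N \<phi> \<Omega>1 \<Omega>2 q \<zeta> \<gamma> x0 (Suc k) =
     (let x = relaxation_x n A M N \<phi> \<Omega>1 \<Omega>2 q \<zeta> \<gamma> x0 k;
          z = z_of n A q \<gamma> \<Omega>2 x
      in mat_inv (\<Omega>2 + M * \<Omega>1 + \<phi> * \<Omega>1) *\<^sub>v
           ((N * \<Omega>1 + \<phi> * \<Omega>1) *\<^sub>v x + (\<Omega>2 - A * \<Omega>1) *\<^sub>v vabs x
             - \<gamma> \<cdot>\<^sub>v (A *\<^sub>v \<zeta> z) - \<gamma> \<cdot>\<^sub>v q))"

definition relaxation_z ::
  "nat \<Rightarrow> real mat \<Rightarrow> real mat \<Rightarrow> real mat \<Rightarrow> real mat \<Rightarrow> real mat \<Rightarrow> real mat \<Rightarrow>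
   real vec \<Rightarrow> (real vec \<Rightarrow> real vec) \<Rightarrow> real \<Rightarrow> real vec \<Rightarrow> nat \<Rightarrow> real vec" where
  "relaxation_z n A M N \<phi> \<Omega>1 \<Omega>2 q \<zeta> \<gamma> x0 k =
     z_of n A q \<gamma> \<Omega>2 (relaxation_x n A M N \<phi> \<Omega>1 \<Omega>2 q \<zeta> \<gamma> x0 k)"

text \<open>The type \<^typ>\<open>real vec\<close> contains vectors of all dimensions and carries no topology;
  convergence within \<open>\<real>\<^sup>n\<close> is that of the product topology.\<close>

definition vec_converges :: "nat \<Rightarrow> (nat \<Rightarrow> real vec) \<Rightarrow> real vec \<Rightarrow> bool" where
  "vec_converges n s l \<longleftrightarrow> (\<forall>k. s k \<in> carrier_vec n) \<and> l \<in> carrier_vec n \<and>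
     (\<forall>i<n. (\<lambda>k. s k $ i) \<longlonglongrightarrow> l $ i)"

end

theory Submission
  imports Defs
begin

text \<open>Complementarity lets one vector \<open>x'\<close> encode the solution \<open>z'\<close>: its scaled positive and
  negative parts are \<open>z' - \<zeta> z'\<close> and \<open>A z' + q\<close>, and the problem then says that \<open>x'\<close> is a fixed
  point of the iteration map \<open>F\<close>. Since \<open>\<bar>\<bar>a\<bar> - \<bar>b\<bar>\<bar> \<le> \<bar>a - b\<bar>\<close>, this map satisfies
  \<open>\<bar>F x - F y\<bar> \<le> L \<bar>x - y\<bar>\<close> entrywise, so the error after \<open>k\<close> steps is at most \<open>L\<^sup>k\<close> times
  the initial one. As \<open>L\<close> has spectral radius below 1, the iterates tend to \<open>x'\<close>, and the
  vectors \<open>z\<close>, which depend continuously on the iterates, tend to \<open>z'\<close>.\<close>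

section \<open>Entrywise order on real vectors and matrices\<close>

lemma vabs_mult_mat_vec_le:
  assumes "A \<in> carrier_mat nr n" and "v \<in> carrier_vec n"
  shows "vabs (A *\<^sub>v v) \<le> mabs A *\<^sub>v vabs v"
  using assms
  by (auto simp: less_eq_vec_def scalar_prod_def abs_mult intro!: sum_abs[THEN order_trans])

lemma mult_mat_vec_mono:
  fixes A :: "real mat"
  assumes "A \<in> carrier_mat nr n" and "0\<^sub>m nr n \<le> A"
    and "v \<in> carrier_vec n" and "w \<in> carrier_vec n" and "v \<le> w"
  shows "A *\<^sub>v v \<le> A *\<^sub>v w"
  using assms
  by (auto simp: less_eq_vec_def less_eq_mat_def scalar_prod_def intro!: sum_mono mult_left_mono)

lemma mabs_nonneg: "A \<in> carrier_mat nr n \<Longrightarrow> 0\<^sub>m nr n \<le> mabs A"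
  by (auto simp: less_eq_mat_def)

lemma mult_mat_nonneg:
  fixes A B :: "real mat"
  assumes "A \<in> carrier_mat n m" and "B \<in> carrier_mat m l"
    and "0\<^sub>m n m \<le> A" and "0\<^sub>m m l \<le> B"
  shows "0\<^sub>m n l \<le> A * B"
  using assms
  by (auto simp: less_eq_mat_def scalar_prod_def intro!: sum_nonneg)

lemma add_mat_nonneg:
  fixes A B :: "real mat"
  assumes "A \<in> carrier_mat n m" and "B \<in> carrier_mat n m"
    and "0\<^sub>m n m \<le> A" and "0\<^sub>m n m \<le> B"
  shows "0\<^sub>m n m \<le> A + B"
  using assms by (auto simp: less_eq_mat_def)

lemma smult_mat_nonneg:
  fixes A :: "real mat"
  assumes "A \<in> carrier_mat n m" and "0\<^sub>m n m \<le> A" and "0 \<le> c"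
  shows "0\<^sub>m n m \<le> c \<cdot>\<^sub>m A"
  using assms by (auto simp: less_eq_mat_def)

lemma smult_mat_mult_vec:
  fixes A :: "'a :: comm_ring_1 mat"
  assumes "A \<in> carrier_mat nr n" and "v \<in> carrier_vec n"
  shows "(c \<cdot>\<^sub>m A) *\<^sub>v v = c \<cdot>\<^sub>v (A *\<^sub>v v)"
  using assms by (intro eq_vecI) (auto simp: scalar_prod_def sum_distrib_left ac_simps)

lemma index_mult_mat_vec_sum:
  assumes "A \<in> carrier_mat nr n" and "v \<in> carrier_vec n" and "i < nr"
  shows "(A *\<^sub>v v) $ i = (\<Sum>j<n. A $$ (i, j) * v $ j)"
  using assms by (auto simp: scalar_prod_def atLeast0LessThan)

lemma diagonal_mat_mult_vec:
  fixes D :: "real mat"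
  assumes "D \<in> carrier_mat n n" and "diagonal_mat D" and "v \<in> carrier_vec n" and "i < n"
  shows "(D *\<^sub>v v) $ i = D $$ (i, i) * v $ i"
proof -
  have "(D *\<^sub>v v) $ i = (\<Sum>j<n. D $$ (i, j) * v $ j)"
    using assms by (intro index_mult_mat_vec_sum)
  also have "\<dots> = (\<Sum>j<n. if j = i then D $$ (i, i) * v $ i else 0)"
    using assms by (intro sum.cong) (auto simp: diagonal_mat_def)
  also have "\<dots> = D $$ (i, i) * v $ i"
    using assms by simp
  finally show ?thesis .
qed

section \<open>Inverses and determinants\<close>

text \<open>A nonzero determinant makes the matrix a unit of the ring of square matrices, which
  rules out the value \<open>None\<close> of \<open>mat_inverse\<close>. Only then does
  \<open>mat_inv\<close> stand for a genuine inverse.\<close>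

lemma mat_inv_det:
  assumes "A \<in> carrier_mat n n" and "det A \<noteq> 0"
  shows "mat_inv A \<in> carrier_mat n n" and "A * mat_inv A = 1\<^sub>m n" and "mat_inv A * A = 1\<^sub>m n"
proof -
  obtain B where "mat_inverse A = Some B"
    using mat_inverse(1)[OF assms(1)] det_non_zero_imp_unit[OF assms] by fast
  with mat_inverse(2)[OF assms(1) this]
  show "mat_inv A \<in> carrier_mat n n" "A * mat_inv A = 1\<^sub>m n" "mat_inv A * A = 1\<^sub>m n"
    by (auto simp: mat_inv_def)
qed

lemma invertible_mat_det_nonzero:
  fixes A :: "'a :: field mat"
  assumes "A \<in> carrier_mat n n" and "invertible_mat A"
  shows "det A \<noteq> 0"
proof -
  obtain B where B: "A * B = 1\<^sub>m n" "B * A = 1\<^sub>m (dim_row B)"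
    using assms by (auto simp: invertible_mat_def inverts_mat_def)
  \<comment> \<open>Invertibility does not state the dimensions of the inverse; counting the columns
    on both sides of the two products fixes them.\<close>
  have "dim_col B = n" "dim_row B = n"
    using arg_cong[OF B(1), of dim_col] arg_cong[OF B(2), of dim_col] assms(1) by auto
  then have "B \<in> carrier_mat n n" by auto
  with det_mult[OF assms(1) this] B(1) have "det A * det B = 1" by simp
  then show ?thesis by auto
qed

text \<open>The determinant is itself a principal minor, the one for the full index set, and this
  set is nonempty because \<open>0 < n\<close>.\<close>

lemma P_matrix_det_nonzero:
  assumes "0 < n" and "P_matrix n A"
  shows "det A \<noteq> 0"
proof -
  have A: "A \<in> carrier_mat n n"
    using assms(2) by (simp add: P_matrix_def)
  \<comment> \<open>\<open>pick\<close> enumerates a set in increasing order, so on an initial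
    segment it is the identity and the full submatrix keeps every index in place.\<close>
  have pick: "pick {0..<n} i = i" if "i < n" for i
  proof -
    have "{a \<in> {0..<n}. a < i} = {0..<i}" using that by auto
    then show ?thesis using pick_card_in_set[of i "{0..<n}"] that by simp
  qed
  have "{i. i < n \<and> i \<in> {0..<n}} = {0..<n}" by auto
  then have "submatrix A {0..<n} {0..<n} = A"
    using A by (intro eq_matI) (auto simp: submatrix_def pick)
  moreover have "det (submatrix A {0..<n} {0..<n}) > 0"
    using assms by (auto simp: P_matrix_def)
  ultimately show ?thesis by simp
qed

section \<open>Powers of a matrix of spectral radius below 1\<close>

lemma pow_mat_smult:
  fixes A :: "'a :: comm_ring_1 mat"
  assumes "A \<in> carrier_mat n n"
  shows "(c \<cdot>\<^sub>m A) ^\<^sub>m k = c ^ k \<cdot>\<^sub>m (A ^\<^sub>m k)"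
proof (induction k)
  case 0
  then show ?case using assms by (auto intro!: eq_matI)
next
  case (Suc k)
  have "A ^\<^sub>m k \<in> carrier_mat n n" using assms by simp
  with assms Suc show ?case
    by (auto intro!: eq_matI simp: scalar_prod_def sum_distrib_left ac_simps)
qed

lemma pow_mat_map_of_real:
  assumes "A \<in> carrier_mat n n"
  shows "map_mat complex_of_real A ^\<^sub>m k = map_mat complex_of_real (A ^\<^sub>m k)"
  by (rule of_real_hom.mat_hom_pow[OF assms, symmetric])

text \<open>Dividing a matrix by \<open>r\<close> divides its eigenvalues by \<open>r\<close> and
  keeps the eigenvectors. Hence an eigenvalue \<open>ev\<close> of largest modulus of the scaled
  matrix gives the eigenvalue \<open>r * ev\<close> of \<open>A\<close>, whose modulus is below
  \<open>r\<close>.\<close>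

lemma spectral_radius_smult_less_1:
  fixes A :: "complex mat"
  assumes A: "A \<in> carrier_mat n n" and n: "0 < n" and r: "spectral_radius A < r" "0 < r"
  shows "spectral_radius (complex_of_real (1 / r) \<cdot>\<^sub>m A) < 1"
proof -
  let ?B = "complex_of_real (1 / r) \<cdot>\<^sub>m A"
  have B: "?B \<in> carrier_mat n n" using A by simp
  obtain ev where ev: "ev \<in> spectrum ?B" "spectral_radius ?B = norm ev"
    using spectral_radius_mem_max(1)[OF B n] by auto
  then obtain v where v: "v \<in> carrier_vec n" "v \<noteq> 0\<^sub>v n" "?B *\<^sub>v v = ev \<cdot>\<^sub>v v"
    using A by (auto simp: spectrum_def eigenvalue_def eigenvector_def)
  have "A *\<^sub>v v = complex_of_real r \<cdot>\<^sub>v (?B *\<^sub>v v)"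
    using A v(1) r by (simp add: smult_mat_mult_vec[OF A v(1)] smult_smult_assoc)
  then have "A *\<^sub>v v = (complex_of_real r * ev) \<cdot>\<^sub>v v"
    by (simp only: v(3) smult_smult_assoc)
  then have "complex_of_real r * ev \<in> spectrum A"
    using A v by (auto simp: spectrum_def eigenvalue_def eigenvector_def)
  then have "norm (complex_of_real r * ev) \<le> spectral_radius A"
    using spectral_radius_mem_max(2)[OF A n] by blast
  with r(2) have "r * norm ev \<le> spectral_radius A" by (simp add: norm_mult)
  with r(1) have "r * norm ev < r * 1" by linarith
  with r(2) have "norm ev < 1" by (simp only: mult_less_cancel_left_pos)
  with ev(2) show ?thesis by simp
qed

text \<open>The powers of a matrix of spectral radius below 1 are known to be bounded;
  applied to \<open>A\<close> divided by some \<open>r\<close> strictly between the spectral radius and 1,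
  this gives entries of size \<open>O(r ^ k)\<close>.\<close>

lemma spectral_radius_less_1_pow_tendsto_0:
  assumes A: "A \<in> carrier_mat n n" and n: "0 < n"
    and sr: "spectral_radius (map_mat complex_of_real A) < 1"
    and ij: "i < n" "j < n"
  shows "(\<lambda>k. (A ^\<^sub>m k) $$ (i, j)) \<longlonglongrightarrow> 0"
proof -
  let ?C = "map_mat complex_of_real A"
  have C: "?C \<in> carrier_mat n n" using A by simp
  \<comment> \<open>Nonnegativity of the spectral radius makes every \<open>r\<close> above it
    positive, so that dividing by \<open>r\<close> is possible.\<close>
  have "0 \<le> spectral_radius ?C"
    using spectral_radius_mem_max(1)[OF C n] by auto
  with sr obtain r where r: "spectral_radius ?C < r" "0 < r" "r < 1"
    by (metis dense le_less_trans)
  let ?B = "complex_of_real (1 / r) \<cdot>\<^sub>m ?C"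
  have B: "?B \<in> carrier_mat n n" using C by simp
  obtain c where c: "norm_bound (?B ^\<^sub>m k) c" for k
    using spectral_radius_jnf_norm_bound_less_1_upper_triangular
      [OF B spectral_radius_smult_less_1[OF C n r(1,2)]] by blast
  have bound: "norm ((A ^\<^sub>m k) $$ (i, j)) \<le> c * r ^ k" for k
  proof -
    have "A ^\<^sub>m k \<in> carrier_mat n n" using A by simp
    then have "i < dim_row (A ^\<^sub>m k)" "j < dim_col (A ^\<^sub>m k)" using ij by auto
    then have "norm ((?B ^\<^sub>m k) $$ (i, j)) = \<bar>(A ^\<^sub>m k) $$ (i, j)\<bar> / r ^ k"
      using r(2)
      by (simp add: pow_mat_smult[OF C] pow_mat_map_of_real[OF A] norm_mult norm_divide
          norm_power power_divide)
    moreover have "norm ((?B ^\<^sub>m k) $$ (i, j)) \<le> c"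
      using c[of k] carrier_matD[OF pow_carrier_mat[OF B, of k]] ij
      unfolding norm_bound_def by metis
    ultimately show ?thesis using r(2) by (simp add: pos_divide_le_eq)
  qed
  have "(\<lambda>k. r ^ k) \<longlonglongrightarrow> 0"
    using r by (intro LIMSEQ_power_zero) simp
  then show ?thesis
    by (rule tendsto_0_le[where K = c]) (use bound r in \<open>simp add: mult.commute norm_power\<close>)
qed

text \<open>Needed because \<open>pow_mat\<close> appends the new factor on the right, whereas
  iterating an error bound produces it on the left.\<close>

lemma mult_pow_mat_commute:
  assumes "A \<in> carrier_mat n n"
  shows "A * A ^\<^sub>m k = A ^\<^sub>m k * (A :: 'a :: semiring_1 mat)"
proof (induction k)
  case 0
  then show ?case using assms by simp
next
  case (Suc k)
  have "A ^\<^sub>m k \<in> carrier_mat n n" using assms by simp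
  with assms Suc show ?case
    by (simp flip: assoc_mult_mat[of A n n "A ^\<^sub>m k" n A n])
qed

section \<open>Entrywise convergence and contractions with a matrix constant\<close>

lemma vec_converges_mult_mat_vec:
  assumes "A \<in> carrier_mat n n" and "vec_converges n s l"
  shows "vec_converges n (\<lambda>k. A *\<^sub>v s k) (A *\<^sub>v l)"
  using assms
  by (auto simp: vec_converges_def scalar_prod_def carrier_vecD[of _ n]
      intro!: tendsto_sum tendsto_mult)

lemma vec_converges_minus:
  assumes "vec_converges n s l" and "vec_converges n t m"
  shows "vec_converges n (\<lambda>k. s k - t k) (l - m)"
  using assms by (auto simp: vec_converges_def carrier_vecD[of _ n] intro!: tendsto_diff)

lemma vec_converges_const: "l \<in> carrier_vec n \<Longrightarrow> vec_converges n (\<lambda>_. l) l"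
  by (simp add: vec_converges_def)

lemma vec_converges_vabs:
  assumes "vec_converges n s l"
  shows "vec_converges n (\<lambda>k. vabs (s k)) (vabs l)"
  using assms by (auto simp: vec_converges_def carrier_vecD[of _ n] intro!: tendsto_rabs)

text \<open>Comparing each step with the fixed point multiplies the vector of entrywise errors by
  \<open>L\<close>. Since \<open>L\<close> is nonnegative, multiplication by it is monotone and
  these bounds can be chained; no norm in which \<open>L\<close> is a contraction has to be
  constructed.\<close>

lemma contraction_vec_converges:
  fixes F :: "real vec \<Rightarrow> real vec" and s :: "nat \<Rightarrow> real vec"
  assumes n: "0 < n" and L: "L \<in> carrier_mat n n" "0\<^sub>m n n \<le> L"
    and sr: "spectral_radius (map_mat complex_of_real L) < 1"
    and F: "F \<in> carrier_vec n \<rightarrow> carrier_vec n"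
    and lip: "\<And>x y. x \<in> carrier_vec n \<Longrightarrow> y \<in> carrier_vec n \<Longrightarrow>
      vabs (F x - F y) \<le> L *\<^sub>v vabs (x - y)"
    and l: "l \<in> carrier_vec n" "F l = l"
    and s0: "s 0 \<in> carrier_vec n" and s_Suc: "\<And>k. s (Suc k) = F (s k)"
  shows "vec_converges n s l"
proof -
  have s: "s k \<in> carrier_vec n" for k
    using F s0 by (induction k) (auto simp: s_Suc)
  let ?e = "vabs (s 0 - l)"
  have e: "?e \<in> carrier_vec n" using s l by simp
  have bound: "vabs (s k - l) \<le> L ^\<^sub>m k *\<^sub>v ?e" for k
  proof (induction k)
    case 0
    show ?case using L(1) e one_mult_mat_vec[OF e] by simp
  next
    case (Suc k)
    have Lk: "L ^\<^sub>m k \<in> carrier_mat n n" using L(1) by simp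
    have "vabs (s (Suc k) - l) \<le> L *\<^sub>v vabs (s k - l)"
      using lip[OF s l(1), of k] by (simp add: s_Suc l(2))
    also have "\<dots> \<le> L *\<^sub>v (L ^\<^sub>m k *\<^sub>v ?e)"
      using L s l(1) mult_mat_vec_carrier[OF Lk e] Suc by (intro mult_mat_vec_mono) auto
    also have "\<dots> = (L * L ^\<^sub>m k) *\<^sub>v ?e"
      by (rule assoc_mult_mat_vec[OF L(1) Lk e, symmetric])
    also have "\<dots> = L ^\<^sub>m Suc k *\<^sub>v ?e"
      by (simp only: mult_pow_mat_commute[OF L(1)] pow_mat.simps)
    finally show ?case .
  qed
  have "(\<lambda>k. s k $ i) \<longlonglongrightarrow> l $ i" if i: "i < n" for i
  proof -
    \<comment> \<open>The number of summands does not depend on \<open>k\<close>, so it is enough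
      that every entry of the powers of \<open>L\<close> tends to 0.\<close>
    have lim: "(\<lambda>k. \<Sum>j<n. (L ^\<^sub>m k) $$ (i, j) * ?e $ j) \<longlonglongrightarrow> 0"
      using spectral_radius_less_1_pow_tendsto_0[OF L(1) n sr i]
      by (intro tendsto_null_sum tendsto_mult_left_zero) auto
    have "norm (s k $ i - l $ i) \<le> (\<Sum>j<n. (L ^\<^sub>m k) $$ (i, j) * ?e $ j)" for k
    proof -
      have Lk: "L ^\<^sub>m k \<in> carrier_mat n n" using L(1) by simp
      have "vabs (s k - l) $ i \<le> (L ^\<^sub>m k *\<^sub>v ?e) $ i"
        using bound[of k] carrier_vecD[OF mult_mat_vec_carrier[OF Lk e]] i
        unfolding less_eq_vec_def by metis
      moreover have "vabs (s k - l) $ i = norm (s k $ i - l $ i)"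
        using s[of k] l i by simp
      moreover have "(L ^\<^sub>m k *\<^sub>v ?e) $ i = (\<Sum>j<n. (L ^\<^sub>m k) $$ (i, j) * ?e $ j)"
        by (rule index_mult_mat_vec_sum[OF Lk e i])
      ultimately show ?thesis by simp
    qed
    then have "(\<lambda>k. s k $ i - l $ i) \<longlonglongrightarrow> 0"
      by (intro tendsto_0_le[where K = 1, OF lim] always_eventually)
        (auto intro: order_trans[OF _ abs_ge_self])
    then show ?thesis by (rule LIM_zero_cancel)
  qed
  with s l show ?thesis by (simp add: vec_converges_def)
qed

section \<open>Dependence of \<open>z\<close> on the iterate \<open>x\<close>\<close>

text \<open>Multiplying by \<open>mat_inv A\<close> from the left shows that the linear system has
  at most one solution, which is what the definite description in \<open>z_of\<close>
  requires.\<close>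

lemma z_of_eqI:
  assumes A: "A \<in> carrier_mat n n" "det A \<noteq> 0" and z: "z \<in> carrier_vec n"
    and eq: "A *\<^sub>v z = ((1 / \<gamma>) \<cdot>\<^sub>m \<Omega>2) *\<^sub>v (vabs x - x) - q"
  shows "z_of n A q \<gamma> \<Omega>2 x = z"
  unfolding z_of_def
proof (rule the_equality)
  show "z \<in> carrier_vec n \<and> A *\<^sub>v z = ((1 / \<gamma>) \<cdot>\<^sub>m \<Omega>2) *\<^sub>v (vabs x - x) - q"
    using z eq by simp
next
  fix y
  assume y: "y \<in> carrier_vec n \<and> A *\<^sub>v y = ((1 / \<gamma>) \<cdot>\<^sub>m \<Omega>2) *\<^sub>v (vabs x - x) - q"
  have cancel: "mat_inv A *\<^sub>v (A *\<^sub>v v) = v" if v: "v \<in> carrier_vec n" for v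
    using assoc_mult_mat_vec[OF mat_inv_det(1)[OF A] A(1) v] v
    by (simp only: mat_inv_det(3)[OF A] one_mult_mat_vec)
  from y eq have "A *\<^sub>v y = A *\<^sub>v z" by argo
  with cancel y z show "y = z" by metis
qed

text \<open>This closed form replaces the definite description; the dimension of \<open>z\<close>,
  its Lipschitz bound and its continuity in \<open>x\<close> are all read off from it.\<close>

lemma z_of_eq:
  assumes "A \<in> carrier_mat n n" and "det A \<noteq> 0"
    and "\<Omega>2 \<in> carrier_mat n n" and "q \<in> carrier_vec n" and "x \<in> carrier_vec n"
  shows "z_of n A q \<gamma> \<Omega>2 x = mat_inv A *\<^sub>v (((1 / \<gamma>) \<cdot>\<^sub>m \<Omega>2) *\<^sub>v (vabs x - x) - q)"
proof (rule z_of_eqI)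
  let ?w = "((1 / \<gamma>) \<cdot>\<^sub>m \<Omega>2) *\<^sub>v (vabs x - x) - q"
  have w: "?w \<in> carrier_vec n"
    using assms by (intro minus_carrier_vec mult_mat_vec_carrier[of _ n n]) auto
  show "mat_inv A *\<^sub>v ?w \<in> carrier_vec n"
    using mat_inv_det(1)[OF assms(1,2)] w by simp
  have "(A * mat_inv A) *\<^sub>v ?w = A *\<^sub>v (mat_inv A *\<^sub>v ?w)"
    by (rule assoc_mult_mat_vec[OF assms(1) mat_inv_det(1)[OF assms(1,2)] w])
  then show "A *\<^sub>v (mat_inv A *\<^sub>v ?w) = ?w"
    using mat_inv_det(2)[OF assms(1,2)] w by simp
qed (use assms in auto)

text \<open>The vector \<open>q\<close> cancels in the difference. Both \<open>x\<close> and
  \<open>vabs x\<close> enter the right-hand side of the linear system, and each of them changes by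
  at most \<open>vabs (x - y)\<close>; this is the origin of the factor 2 in
  \<open>L\<close>.\<close>

lemma vabs_z_of_diff_le:
  assumes A: "A \<in> carrier_mat n n" "det A \<noteq> 0" and \<gamma>: "0 < \<gamma>"
    and \<Omega>2: "\<Omega>2 \<in> carrier_mat n n" "pos_diagonal_mat \<Omega>2"
    and q: "q \<in> carrier_vec n" and x: "x \<in> carrier_vec n" and y: "y \<in> carrier_vec n"
  shows "vabs (z_of n A q \<gamma> \<Omega>2 x - z_of n A q \<gamma> \<Omega>2 y) \<le>
    (2 / \<gamma>) \<cdot>\<^sub>v (mabs (mat_inv A) *\<^sub>v (\<Omega>2 *\<^sub>v vabs (x - y)))"
proof -
  note inv = mat_inv_det[OF A]
  let ?g = "\<lambda>x. ((1 / \<gamma>) \<cdot>\<^sub>m \<Omega>2) *\<^sub>v (vabs x - x) - q"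
  have S: "(1 / \<gamma>) \<cdot>\<^sub>m \<Omega>2 \<in> carrier_mat n n" using \<Omega>2 by simp
  have g: "?g v \<in> carrier_vec n" if "v \<in> carrier_vec n" for v
    using S q that by (intro minus_carrier_vec mult_mat_vec_carrier) auto
  have diag: "diagonal_mat \<Omega>2" "\<And>i. i < n \<Longrightarrow> 0 < \<Omega>2 $$ (i, i)"
    using \<Omega>2 by (auto simp: pos_diagonal_mat_def)
  \<comment> \<open>Since \<open>\<Omega>2\<close> is diagonal, entry \<open>i\<close> of its
    product with a vector involves entry \<open>i\<close> of that vector only, and the positive
    factor \<open>?d\<close> can be moved out of the absolute value.\<close>
  have le: "vabs (?g x - ?g y) \<le> (2 / \<gamma>) \<cdot>\<^sub>v (\<Omega>2 *\<^sub>v vabs (x - y))"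
    unfolding less_eq_vec_def
  proof (intro conjI allI impI)
    show "dim_vec (vabs (?g x - ?g y)) = dim_vec ((2 / \<gamma>) \<cdot>\<^sub>v (\<Omega>2 *\<^sub>v vabs (x - y)))"
      using \<Omega>2 q by simp
    fix i
    assume "i < dim_vec ((2 / \<gamma>) \<cdot>\<^sub>v (\<Omega>2 *\<^sub>v vabs (x - y)))"
    then have i: "i < n" using \<Omega>2 by simp
    let ?d = "\<Omega>2 $$ (i, i)"
    have comp: "?g v $ i = (1 / \<gamma>) * (?d * (\<bar>v $ i\<bar> - v $ i)) - q $ i"
      if v: "v \<in> carrier_vec n" for v
    proof -
      have "vabs v - v \<in> carrier_vec n" using v by simp
      then show ?thesis
        using i q v \<Omega>2(1) diagonal_mat_mult_vec[OF \<Omega>2(1) diag(1), of "vabs v - v" i]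
        by (simp add: smult_mat_mult_vec[OF \<Omega>2(1)] del: index_mult_mat_vec)
    qed
    have ineq: "\<bar>(\<bar>a\<bar> - \<bar>b\<bar>) - (a - b)\<bar> \<le> 2 * \<bar>a - b\<bar>" for a b :: real
    proof -
      have "\<bar>(\<bar>a\<bar> - \<bar>b\<bar>) - (a - b)\<bar> \<le> \<bar>\<bar>a\<bar> - \<bar>b\<bar>\<bar> + \<bar>a - b\<bar>"
        by (rule abs_triangle_ineq4)
      also have "\<dots> \<le> \<bar>a - b\<bar> + \<bar>a - b\<bar>"
        by (intro add_right_mono abs_triangle_ineq3)
      finally show ?thesis by simp
    qed
    have "vabs (?g x - ?g y) $ i = \<bar>?g x $ i - ?g y $ i\<bar>"
      using i carrier_vecD[OF g[OF x]] carrier_vecD[OF g[OF y]]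
      by (simp only: index_map_vec index_minus_vec)
    also have "\<dots> = \<bar>(?d / \<gamma>) * ((\<bar>x $ i\<bar> - \<bar>y $ i\<bar>) - (x $ i - y $ i))\<bar>"
      unfolding comp[OF x] comp[OF y] by (rule arg_cong[of _ _ abs]) (simp add: algebra_simps)
    also have "\<dots> = (?d / \<gamma>) * \<bar>(\<bar>x $ i\<bar> - \<bar>y $ i\<bar>) - (x $ i - y $ i)\<bar>"
      using diag(2)[OF i] \<gamma> by (simp add: abs_mult)
    also have "\<dots> \<le> (?d / \<gamma>) * (2 * \<bar>x $ i - y $ i\<bar>)"
      using diag(2)[OF i] \<gamma> by (intro mult_left_mono ineq) simp
    also have "\<dots> = ((2 / \<gamma>) \<cdot>\<^sub>v (\<Omega>2 *\<^sub>v vabs (x - y))) $ i"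
      using i x y \<Omega>2(1) diagonal_mat_mult_vec[OF \<Omega>2(1) diag(1), of "vabs (x - y)" i]
      by (simp del: index_mult_mat_vec)
    finally show "vabs (?g x - ?g y) $ i \<le> ((2 / \<gamma>) \<cdot>\<^sub>v (\<Omega>2 *\<^sub>v vabs (x - y))) $ i" .
  qed
  have "z_of n A q \<gamma> \<Omega>2 x - z_of n A q \<gamma> \<Omega>2 y = mat_inv A *\<^sub>v (?g x - ?g y)"
    by (simp only: z_of_eq[OF A \<Omega>2(1) q x] z_of_eq[OF A \<Omega>2(1) q y]
        mult_minus_distrib_mat_vec[OF inv(1) g[OF x] g[OF y]])
  also have "vabs \<dots> \<le> mabs (mat_inv A) *\<^sub>v vabs (?g x - ?g y)"
    using inv(1) g x y by (intro vabs_mult_mat_vec_le[of _ n n]) auto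
  also have "\<dots> \<le> mabs (mat_inv A) *\<^sub>v ((2 / \<gamma>) \<cdot>\<^sub>v (\<Omega>2 *\<^sub>v vabs (x - y)))"
  proof (rule mult_mat_vec_mono[OF _ _ _ _ le])
    show "vabs (?g x - ?g y) \<in> carrier_vec n"
      using g[OF x] g[OF y] minus_carrier_vec by simp
    show "(2 / \<gamma>) \<cdot>\<^sub>v (\<Omega>2 *\<^sub>v vabs (x - y)) \<in> carrier_vec n"
      using \<Omega>2(1) x y by (intro smult_carrier_vec[THEN iffD2] mult_mat_vec_carrier) auto
  qed (use inv(1) mabs_nonneg in auto)
  also have "\<dots> = (2 / \<gamma>) \<cdot>\<^sub>v (mabs (mat_inv A) *\<^sub>v (\<Omega>2 *\<^sub>v vabs (x - y)))"
    using inv(1) \<Omega>2(1) x y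
    by (intro mult_mat_vec[of _ n n] mult_mat_vec_carrier) auto
  finally show ?thesis .
qed

section \<open>The iteration map and its Lipschitz matrix\<close>

text \<open>The coefficient matrices are kept as parameters \<open>H\<close>, \<open>G\<close> and
  \<open>B\<close>, since the Lipschitz estimate does not depend on how they arise from the
  splitting. The splitting matters only for the fixed point.\<close>

definition relaxation_step ::
  "nat \<Rightarrow> real mat \<Rightarrow> real mat \<Rightarrow> real mat \<Rightarrow> real mat \<Rightarrow> real mat \<Rightarrow>
   real vec \<Rightarrow> (real vec \<Rightarrow> real vec) \<Rightarrow> real \<Rightarrow> real vec \<Rightarrow> real vec" where
  "relaxation_step n A H G B \<Omega>2 q \<zeta> \<gamma> x =
     mat_inv H *\<^sub>v (G *\<^sub>v x + B *\<^sub>v vabs x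
       - \<gamma> \<cdot>\<^sub>v (A *\<^sub>v \<zeta> (z_of n A q \<gamma> \<Omega>2 x)) - \<gamma> \<cdot>\<^sub>v q)"

lemma relaxation_x_Suc:
  "relaxation_x n A M N \<phi> \<Omega>1 \<Omega>2 q \<zeta> \<gamma> x0 (Suc k) =
     relaxation_step n A (\<Omega>2 + M * \<Omega>1 + \<phi> * \<Omega>1) (N * \<Omega>1 + \<phi> * \<Omega>1) (\<Omega>2 - A * \<Omega>1) \<Omega>2 q \<zeta> \<gamma>
       (relaxation_x n A M N \<phi> \<Omega>1 \<Omega>2 q \<zeta> \<gamma> x0 k)"
  by (simp add: relaxation_step_def Let_def)

lemma z_of_carrier:
  assumes "A \<in> carrier_mat n n" and "det A \<noteq> 0"
    and "\<Omega>2 \<in> carrier_mat n n" and "q \<in> carrier_vec n" and "x \<in> carrier_vec n"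
  shows "z_of n A q \<gamma> \<Omega>2 x \<in> carrier_vec n"
  unfolding z_of_eq[OF assms]
  using assms mat_inv_det(1)[OF assms(1,2)]
  by (intro mult_mat_vec_carrier[of _ n n] minus_carrier_vec) auto

lemma relaxation_step_carrier:
  assumes H: "H \<in> carrier_mat n n" "det H \<noteq> 0" and q: "q \<in> carrier_vec n"
  shows "relaxation_step n A H G B \<Omega>2 q \<zeta> \<gamma> x \<in> carrier_vec n"
  using mat_inv_det(1)[OF H] q unfolding relaxation_step_def carrier_vec_def by auto

text \<open>The term with \<open>q\<close> cancels in the difference. The other three terms give the
  three summands of the matrix: \<open>G\<close> acts linearly on \<open>x\<close>, \<open>B\<close>
  acts on \<open>vabs x\<close>, and the term with \<open>\<zeta>\<close> chains the bound
  \<open>\<Psi>\<close> for \<open>\<zeta>\<close> with the bound for \<open>z_of\<close>.\<close>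

lemma relaxation_step_lipschitz:
  assumes A: "A \<in> carrier_mat n n" "det A \<noteq> 0" and \<gamma>: "0 < \<gamma>"
    and \<Omega>2: "\<Omega>2 \<in> carrier_mat n n" "pos_diagonal_mat \<Omega>2"
    and H: "H \<in> carrier_mat n n" "det H \<noteq> 0"
    and G: "G \<in> carrier_mat n n" and B: "B \<in> carrier_mat n n"
    and q: "q \<in> carrier_vec n" and \<zeta>: "\<zeta> \<in> carrier_vec n \<rightarrow> carrier_vec n"
    and \<Psi>: "\<Psi> \<in> carrier_mat n n" "0\<^sub>m n n \<le> \<Psi>"
    and lip: "\<forall>x\<in>carrier_vec n. \<forall>y\<in>carrier_vec n. vabs (\<zeta> x - \<zeta> y) \<le> \<Psi> *\<^sub>v vabs (x - y)"
    and x: "x \<in> carrier_vec n" and y: "y \<in> carrier_vec n"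
  shows "vabs (relaxation_step n A H G B \<Omega>2 q \<zeta> \<gamma> x - relaxation_step n A H G B \<Omega>2 q \<zeta> \<gamma> y) \<le>
    (mabs (mat_inv H) * (mabs G + mabs B + 2 \<cdot>\<^sub>m (mabs A * \<Psi> * mabs (mat_inv A) * \<Omega>2)))
      *\<^sub>v vabs (x - y)"
proof -
  let ?z = "z_of n A q \<gamma> \<Omega>2"
  let ?r = "\<lambda>x. G *\<^sub>v x + B *\<^sub>v vabs x - \<gamma> \<cdot>\<^sub>v (A *\<^sub>v \<zeta> (?z x)) - \<gamma> \<cdot>\<^sub>v q"
  let ?e = "vabs (x - y)"
  let ?T = "mabs A * \<Psi> * mabs (mat_inv A) * \<Omega>2"
  note Ai = mat_inv_det(1)[OF A] and Hi = mat_inv_det(1)[OF H]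
  have z: "?z v \<in> carrier_vec n" if "v \<in> carrier_vec n" for v
    using z_of_carrier[OF A \<Omega>2(1) q that] .
  have \<zeta>z: "\<zeta> (?z v) \<in> carrier_vec n" if "v \<in> carrier_vec n" for v
    using \<zeta> z[OF that] by blast
  \<comment> \<open>A difference of vectors has the dimension of its second operand, here a multiple
    of \<open>q\<close>, so this holds for every \<open>v\<close>.\<close>
  have r: "?r v \<in> carrier_vec n" for v
    using carrier_vecD[OF q] by (intro carrier_vecI) simp
  have e: "?e \<in> carrier_vec n" using x y by simp
  have AP: "mabs A * \<Psi> \<in> carrier_mat n n" using A \<Psi> by simp
  have T: "?T \<in> carrier_mat n n"
    using A Ai \<Psi> \<Omega>2 by (intro mult_carrier_mat[of _ n n]) simp_all
  let ?w = "mabs (mat_inv A) *\<^sub>v (\<Omega>2 *\<^sub>v ?e)"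
  have \<Omega>e: "\<Omega>2 *\<^sub>v ?e \<in> carrier_vec n"
    by (rule mult_mat_vec_carrier[OF \<Omega>2(1) e])
  have w: "?w \<in> carrier_vec n"
    using Ai by (intro mult_mat_vec_carrier[OF _ \<Omega>e]) simp
  have \<zeta>_le: "vabs (\<zeta> (?z x) - \<zeta> (?z y)) \<le> (2 / \<gamma>) \<cdot>\<^sub>v (\<Psi> *\<^sub>v ?w)"
  proof -
    have "vabs (\<zeta> (?z x) - \<zeta> (?z y)) \<le> \<Psi> *\<^sub>v vabs (?z x - ?z y)"
      using lip z x y by blast
    also have "\<dots> \<le> \<Psi> *\<^sub>v ((2 / \<gamma>) \<cdot>\<^sub>v ?w)"
      using vabs_z_of_diff_le[OF A \<gamma> \<Omega>2 q x y] z x y w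
      by (intro mult_mat_vec_mono[OF \<Psi>]) auto
    also have "\<dots> = (2 / \<gamma>) \<cdot>\<^sub>v (\<Psi> *\<^sub>v ?w)"
      by (rule mult_mat_vec[OF \<Psi>(1) w])
    finally show ?thesis .
  qed
  have A\<zeta>_le: "vabs (A *\<^sub>v (\<zeta> (?z x) - \<zeta> (?z y))) \<le> (2 / \<gamma>) \<cdot>\<^sub>v (?T *\<^sub>v ?e)"
  proof -
    have \<Psi>w: "\<Psi> *\<^sub>v ?w \<in> carrier_vec n"
      by (rule mult_mat_vec_carrier[OF \<Psi>(1) w])
    have "vabs (A *\<^sub>v (\<zeta> (?z x) - \<zeta> (?z y))) \<le> mabs A *\<^sub>v vabs (\<zeta> (?z x) - \<zeta> (?z y))"
      using \<zeta>z x y by (intro vabs_mult_mat_vec_le[OF A(1)]) auto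
    also have "\<dots> \<le> mabs A *\<^sub>v ((2 / \<gamma>) \<cdot>\<^sub>v (\<Psi> *\<^sub>v ?w))"
      using A(1) \<zeta>z x y \<Psi>w by (intro mult_mat_vec_mono[OF _ _ _ _ \<zeta>_le] mabs_nonneg) auto
    also have "\<dots> = (2 / \<gamma>) \<cdot>\<^sub>v (mabs A *\<^sub>v (\<Psi> *\<^sub>v ?w))"
      using A(1) by (intro mult_mat_vec[OF _ \<Psi>w]) simp
    also have "mabs A *\<^sub>v (\<Psi> *\<^sub>v ?w) = (mabs A * \<Psi>) *\<^sub>v ?w"
      using A(1) by (intro assoc_mult_mat_vec[OF _ \<Psi>(1) w, symmetric]) simp
    also have "\<dots> = (mabs A * \<Psi> * mabs (mat_inv A)) *\<^sub>v (\<Omega>2 *\<^sub>v ?e)"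
      using Ai by (intro assoc_mult_mat_vec[OF AP _ \<Omega>e, symmetric]) simp
    also have "\<dots> = ?T *\<^sub>v ?e"
      using AP Ai
      by (intro assoc_mult_mat_vec[OF mult_carrier_mat[OF AP] \<Omega>2(1) e, symmetric]) simp
    finally show ?thesis .
  qed
  have G_le: "vabs (G *\<^sub>v (x - y)) \<le> mabs G *\<^sub>v ?e"
    using x y by (intro vabs_mult_mat_vec_le[OF G]) simp
  \<comment> \<open>The reverse triangle inequality in each entry passes from the difference of
    absolute values to \<open>?e\<close>.\<close>
  have B_le: "vabs (B *\<^sub>v (vabs x - vabs y)) \<le> mabs B *\<^sub>v ?e"
  proof -
    have "vabs (B *\<^sub>v (vabs x - vabs y)) \<le> mabs B *\<^sub>v vabs (vabs x - vabs y)"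
      using x y by (intro vabs_mult_mat_vec_le[OF B]) simp
    also have "\<dots> \<le> mabs B *\<^sub>v ?e"
      using B x y by (intro mult_mat_vec_mono mabs_nonneg) (auto simp: less_eq_vec_def)
    finally show ?thesis .
  qed
  have le: "vabs (?r x - ?r y) \<le> (mabs G + mabs B + 2 \<cdot>\<^sub>m ?T) *\<^sub>v ?e"
    unfolding less_eq_vec_def
  proof (intro conjI allI impI)
    show "dim_vec (vabs (?r x - ?r y)) = dim_vec ((mabs G + mabs B + 2 \<cdot>\<^sub>m ?T) *\<^sub>v ?e)"
      using q A by simp
    fix i
    assume "i < dim_vec ((mabs G + mabs B + 2 \<cdot>\<^sub>m ?T) *\<^sub>v ?e)"
    then have i: "i < n" using A by simp
    have abs_i: "\<bar>u $ i\<bar> \<le> b $ i" if "vabs u \<le> b" "b \<in> carrier_vec n" for u b :: "real vec"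
      using that i by (auto simp: less_eq_vec_def)
    have dims: "dim_row G = n" "dim_row B = n" "dim_row A = n" "dim_vec q = n"
      using G B A q by auto
    have r_i: "?r v $ i = (G *\<^sub>v v) $ i + (B *\<^sub>v vabs v) $ i - \<gamma> * (A *\<^sub>v \<zeta> (?z v)) $ i - \<gamma> * q $ i"
      for v
      using i dims by (simp del: index_mult_mat_vec)
    have "vabs (?r x - ?r y) $ i = \<bar>?r x $ i - ?r y $ i\<bar>"
      using i carrier_vecD[OF r[of x]] carrier_vecD[OF r[of y]]
      by (simp only: index_map_vec index_minus_vec)
    also have "?r x $ i - ?r y $ i = (G *\<^sub>v (x - y)) $ i + (B *\<^sub>v (vabs x - vabs y)) $ i
        - \<gamma> * (A *\<^sub>v (\<zeta> (?z x) - \<zeta> (?z y))) $ i"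
      unfolding r_i mult_minus_distrib_mat_vec[OF G x y]
        mult_minus_distrib_mat_vec[OF A(1) \<zeta>z[OF x] \<zeta>z[OF y]]
        mult_minus_distrib_mat_vec[OF B map_carrier_vec[THEN iffD2, OF x] map_carrier_vec[THEN iffD2, OF y]]
      using i dims by (simp add: algebra_simps del: index_mult_mat_vec)
    also have "\<bar>\<dots>\<bar> \<le> \<bar>(G *\<^sub>v (x - y)) $ i\<bar> + \<bar>(B *\<^sub>v (vabs x - vabs y)) $ i\<bar>
        + \<gamma> * \<bar>(A *\<^sub>v (\<zeta> (?z x) - \<zeta> (?z y))) $ i\<bar>"
    proof -
      have tri: "\<bar>a + b - c\<bar> \<le> \<bar>a\<bar> + \<bar>b\<bar> + \<bar>c\<bar>" for a b c :: real
        by linarith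
      show ?thesis
        using \<gamma> by (intro order_trans[OF tri]) (simp add: abs_mult)
    qed
    also have "\<dots> \<le> (mabs G *\<^sub>v ?e) $ i + (mabs B *\<^sub>v ?e) $ i
        + \<gamma> * ((2 / \<gamma>) \<cdot>\<^sub>v (?T *\<^sub>v ?e)) $ i"
    proof -
      have c: "mabs G *\<^sub>v ?e \<in> carrier_vec n" "mabs B *\<^sub>v ?e \<in> carrier_vec n"
        "(2 / \<gamma>) \<cdot>\<^sub>v (?T *\<^sub>v ?e) \<in> carrier_vec n"
        by (intro smult_carrier_vec[THEN iffD2] mult_mat_vec_carrier[OF _ e]
            map_carrier_mat[THEN iffD2] G B T)+
      show ?thesis
        using \<gamma> by (intro add_mono[OF add_mono[OF abs_i[OF G_le c(1)] abs_i[OF B_le c(2)]]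
            mult_left_mono[OF abs_i[OF A\<zeta>_le c(3)]]]) simp
    qed
    \<comment> \<open>Here \<open>\<gamma>\<close> meets the factor \<open>2 / \<gamma>\<close>
      inherited from the bound for \<open>z_of\<close>, so the final matrix is free of
      \<open>\<gamma>\<close>.\<close>
    also have "\<dots> = (mabs G *\<^sub>v ?e) $ i + (mabs B *\<^sub>v ?e) $ i + 2 * (?T *\<^sub>v ?e) $ i"
      using \<gamma> i carrier_vecD[OF mult_mat_vec_carrier[OF T e]] by (simp del: index_mult_mat_vec)
    also have "\<dots> = ((mabs G + mabs B + 2 \<cdot>\<^sub>m ?T) *\<^sub>v ?e) $ i"
    proof -
      have GB: "mabs G \<in> carrier_mat n n" "mabs B \<in> carrier_mat n n" "2 \<cdot>\<^sub>m ?T \<in> carrier_mat n n"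
        using G B smult_carrier_mat[OF T] by simp_all
      have "(mabs G + mabs B + 2 \<cdot>\<^sub>m ?T) *\<^sub>v ?e = mabs G *\<^sub>v ?e + mabs B *\<^sub>v ?e + 2 \<cdot>\<^sub>v (?T *\<^sub>v ?e)"
        unfolding add_mult_distrib_mat_vec[OF add_carrier_mat[OF GB(2)] GB(3) e]
          add_mult_distrib_mat_vec[OF GB(1,2) e] smult_mat_mult_vec[OF T e] ..
      then show ?thesis
        using i dims carrier_vecD[OF mult_mat_vec_carrier[OF T e]]
        by (simp del: index_mult_mat_vec)
    qed
    finally show "vabs (?r x - ?r y) $ i \<le> ((mabs G + mabs B + 2 \<cdot>\<^sub>m ?T) *\<^sub>v ?e) $ i" .
  qed
  have R: "mabs G + mabs B + 2 \<cdot>\<^sub>m ?T \<in> carrier_mat n n"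
    by (rule add_carrier_mat[OF smult_carrier_mat[OF T]])
  have "relaxation_step n A H G B \<Omega>2 q \<zeta> \<gamma> x - relaxation_step n A H G B \<Omega>2 q \<zeta> \<gamma> y
      = mat_inv H *\<^sub>v (?r x - ?r y)"
    unfolding relaxation_step_def by (rule mult_minus_distrib_mat_vec[OF Hi r r, symmetric])
  also have "vabs \<dots> \<le> mabs (mat_inv H) *\<^sub>v vabs (?r x - ?r y)"
    by (rule vabs_mult_mat_vec_le[OF Hi minus_carrier_vec[OF r r]])
  also have "\<dots> \<le> mabs (mat_inv H) *\<^sub>v ((mabs G + mabs B + 2 \<cdot>\<^sub>m ?T) *\<^sub>v ?e)"
  proof (rule mult_mat_vec_mono[OF _ mabs_nonneg[OF Hi] _ _ le])
    show "vabs (?r x - ?r y) \<in> carrier_vec n"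
      using minus_carrier_vec[OF r r] by (simp only: map_carrier_vec)
    show "(mabs G + mabs B + 2 \<cdot>\<^sub>m ?T) *\<^sub>v ?e \<in> carrier_vec n"
      by (rule mult_mat_vec_carrier[OF R e])
  qed (use Hi in simp)
  also have "\<dots> = (mabs (mat_inv H) * (mabs G + mabs B + 2 \<cdot>\<^sub>m ?T)) *\<^sub>v ?e"
    using Hi by (intro assoc_mult_mat_vec[OF _ R e, symmetric]) simp
  finally show ?thesis .
qed

section \<open>Modulus encoding of a solution\<close>

text \<open>Dividing the two equations by the diagonal matrices turns them into a linear system for
  \<open>vabs x\<close> and \<open>x\<close>. Its solution is consistent, meaning that the first
  part is the absolute value of the second, exactly because the two nonnegative vectors are
  complementary.\<close>

lemma ICP_solution_modulus:
  assumes sol: "ICP_solution n q A \<zeta> z" and \<gamma>: "0 < \<gamma>"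
    and A: "A \<in> carrier_mat n n" and q: "q \<in> carrier_vec n"
    and \<zeta>: "\<zeta> \<in> carrier_vec n \<rightarrow> carrier_vec n"
    and \<Omega>1: "\<Omega>1 \<in> carrier_mat n n" "pos_diagonal_mat \<Omega>1"
    and \<Omega>2: "\<Omega>2 \<in> carrier_mat n n" "pos_diagonal_mat \<Omega>2"
  obtains x where "x \<in> carrier_vec n"
    and "\<Omega>1 *\<^sub>v vabs x + \<Omega>1 *\<^sub>v x = \<gamma> \<cdot>\<^sub>v (z - \<zeta> z)"
    and "\<Omega>2 *\<^sub>v vabs x - \<Omega>2 *\<^sub>v x = \<gamma> \<cdot>\<^sub>v (A *\<^sub>v z + q)"
proof
  define u where "u = z - \<zeta> z"
  define w where "w = A *\<^sub>v z + q"
  have z: "z \<in> carrier_vec n" using sol by (simp add: ICP_solution_def)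
  have u: "u \<in> carrier_vec n"
    unfolding u_def using z \<zeta> by (intro minus_carrier_vec) auto
  have w: "w \<in> carrier_vec n" using A z q by (simp add: w_def)
  have u0: "0 \<le> u $ i" and w0: "0 \<le> w $ i" if "i < n" for i
    using sol that carrier_vecD[OF u] carrier_vecD[OF w]
    unfolding ICP_solution_def less_eq_vec_def u_def[symmetric] w_def[symmetric] by auto
  have "(\<Sum>i<n. u $ i * w $ i) = 0"
    using sol w unfolding ICP_solution_def u_def[symmetric] w_def[symmetric]
    by (simp add: scalar_prod_def atLeast0LessThan)
  \<comment> \<open>All terms of the sum are nonnegative, so the single orthogonality condition
    splits into one condition for each entry.\<close>
  then have uw: "u $ i = 0 \<or> w $ i = 0" if "i < n" for i
    using that u0 w0 by (subst (asm) sum_nonneg_eq_0_iff) auto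
  have d1: "diagonal_mat \<Omega>1" "\<And>i. i < n \<Longrightarrow> 0 < \<Omega>1 $$ (i, i)"
    and d2: "diagonal_mat \<Omega>2" "\<And>i. i < n \<Longrightarrow> 0 < \<Omega>2 $$ (i, i)"
    using \<Omega>1 \<Omega>2 by (auto simp: pos_diagonal_mat_def)
  \<comment> \<open>Half the difference of the two equations, after division by the respective
    diagonal entries.\<close>
  define x where "x = vec n (\<lambda>i. \<gamma> / 2 * (u $ i / \<Omega>1 $$ (i, i) - w $ i / \<Omega>2 $$ (i, i)))"
  show x: "x \<in> carrier_vec n" by (simp add: x_def)
  have absx: "vabs x \<in> carrier_vec n" using x by simp
  \<comment> \<open>Complementarity enters here: with one of two nonnegative terms zero, the
    absolute value of their difference is their sum.\<close>
  have abs_i: "\<bar>x $ i\<bar> = \<gamma> / 2 * (u $ i / \<Omega>1 $$ (i, i) + w $ i / \<Omega>2 $$ (i, i))" if i: "i < n" for i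
    using uw[OF i] u0[OF i] w0[OF i] d1(2)[OF i] d2(2)[OF i] \<gamma> i
    by (auto simp: x_def abs_mult)
  have x_i: "x $ i = \<gamma> / 2 * (u $ i / \<Omega>1 $$ (i, i) - w $ i / \<Omega>2 $$ (i, i))" if i: "i < n" for i
    using i by (simp add: x_def)
  have "\<Omega>1 *\<^sub>v vabs x + \<Omega>1 *\<^sub>v x = \<gamma> \<cdot>\<^sub>v u"
  proof (rule eq_vecI)
    fix i
    assume "i < dim_vec (\<gamma> \<cdot>\<^sub>v u)"
    then have i: "i < n" using u by simp
    have "(\<Omega>1 *\<^sub>v vabs x + \<Omega>1 *\<^sub>v x) $ i = \<Omega>1 $$ (i, i) * (\<bar>x $ i\<bar> + x $ i)"
      using i \<Omega>1(1) carrier_vecD[OF x] diagonal_mat_mult_vec[OF \<Omega>1(1) d1(1) absx i]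
        diagonal_mat_mult_vec[OF \<Omega>1(1) d1(1) x i]
      by (simp add: distrib_left del: index_mult_mat_vec)
    also have "\<dots> = \<gamma> * u $ i"
    proof -
      have "\<bar>x $ i\<bar> + x $ i = \<gamma> * (u $ i / \<Omega>1 $$ (i, i))"
        unfolding abs_i[OF i] unfolding x_i[OF i] by (simp add: algebra_simps)
      then show ?thesis using d1(2)[OF i] by simp
    qed
    finally show "(\<Omega>1 *\<^sub>v vabs x + \<Omega>1 *\<^sub>v x) $ i = (\<gamma> \<cdot>\<^sub>v u) $ i"
      using i u by simp
  qed (use u \<Omega>1(1) in simp)
  then show "\<Omega>1 *\<^sub>v vabs x + \<Omega>1 *\<^sub>v x = \<gamma> \<cdot>\<^sub>v (z - \<zeta> z)" by (simp only: u_def)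
  have "\<Omega>2 *\<^sub>v vabs x - \<Omega>2 *\<^sub>v x = \<gamma> \<cdot>\<^sub>v w"
  proof (rule eq_vecI)
    fix i
    assume "i < dim_vec (\<gamma> \<cdot>\<^sub>v w)"
    then have i: "i < n" using w by simp
    have "(\<Omega>2 *\<^sub>v vabs x - \<Omega>2 *\<^sub>v x) $ i = \<Omega>2 $$ (i, i) * (\<bar>x $ i\<bar> - x $ i)"
      using i \<Omega>2(1) carrier_vecD[OF x] diagonal_mat_mult_vec[OF \<Omega>2(1) d2(1) absx i]
        diagonal_mat_mult_vec[OF \<Omega>2(1) d2(1) x i]
      by (simp add: right_diff_distrib del: index_mult_mat_vec)
    also have "\<dots> = \<gamma> * w $ i"
    proof -
      have "\<bar>x $ i\<bar> - x $ i = \<gamma> * (w $ i / \<Omega>2 $$ (i, i))"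
        unfolding abs_i[OF i] unfolding x_i[OF i] by (simp add: algebra_simps)
      then show ?thesis using d2(2)[OF i] by simp
    qed
    finally show "(\<Omega>2 *\<^sub>v vabs x - \<Omega>2 *\<^sub>v x) $ i = (\<gamma> \<cdot>\<^sub>v w) $ i"
      using i w by simp
  qed (use w \<Omega>2(1) in simp)
  then show "\<Omega>2 *\<^sub>v vabs x - \<Omega>2 *\<^sub>v x = \<gamma> \<cdot>\<^sub>v (A *\<^sub>v z + q)" by (simp only: w_def)
qed

text \<open>Dividing the modulus equation by \<open>\<gamma>\<close> and moving \<open>q\<close> to
  the other side yields the linear system that characterizes \<open>z_of\<close>.\<close>

lemma modulus_z_of:
  assumes A: "A \<in> carrier_mat n n" "det A \<noteq> 0" and \<gamma>: "0 < \<gamma>"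
    and \<Omega>2: "\<Omega>2 \<in> carrier_mat n n" and q: "q \<in> carrier_vec n"
    and x: "x \<in> carrier_vec n" and z: "z \<in> carrier_vec n"
    and eq: "\<Omega>2 *\<^sub>v vabs x - \<Omega>2 *\<^sub>v x = \<gamma> \<cdot>\<^sub>v (A *\<^sub>v z + q)"
  shows "z_of n A q \<gamma> \<Omega>2 x = z"
proof (rule z_of_eqI[OF A z])
  have "vabs x - x \<in> carrier_vec n" "vabs x \<in> carrier_vec n" using x by auto
  then have "((1 / \<gamma>) \<cdot>\<^sub>m \<Omega>2) *\<^sub>v (vabs x - x) = (1 / \<gamma>) \<cdot>\<^sub>v (\<gamma> \<cdot>\<^sub>v (A *\<^sub>v z + q))"
    by (simp only: smult_mat_mult_vec[OF \<Omega>2] mult_minus_distrib_mat_vec[OF \<Omega>2 _ x] eq)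
  also have "\<dots> = A *\<^sub>v z + q"
    using \<gamma> by (simp add: smult_smult_assoc)
  finally have eq': "((1 / \<gamma>) \<cdot>\<^sub>m \<Omega>2) *\<^sub>v (vabs x - x) = A *\<^sub>v z + q" .
  have "A *\<^sub>v z + q - q = A *\<^sub>v z"
    using A(1) q by (intro eq_vecI) (auto simp del: index_mult_mat_vec)
  then show "A *\<^sub>v z = ((1 / \<gamma>) \<cdot>\<^sub>m \<Omega>2) *\<^sub>v (vabs x - x) - q"
    by (simp only: eq')
qed

text \<open>Subtracting \<open>A\<close> times the first modulus equation from the second eliminates
  \<open>A *\<^sub>v z\<close>. After the splitting is inserted, what remains says that the matrix
  to be inverted, applied to \<open>x\<close>, gives the bracket of the iteration.\<close>

lemma modulus_fixed_point:
  assumes M: "M \<in> carrier_mat n n" and N: "N \<in> carrier_mat n n" and \<phi>: "\<phi> \<in> carrier_mat n n"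
    and A: "A = (M + \<phi>) - (N + \<phi>)" "det A \<noteq> 0" and \<gamma>: "0 < \<gamma>"
    and \<Omega>1: "\<Omega>1 \<in> carrier_mat n n" and \<Omega>2: "\<Omega>2 \<in> carrier_mat n n"
    and H: "det (\<Omega>2 + M * \<Omega>1 + \<phi> * \<Omega>1) \<noteq> 0"
    and q: "q \<in> carrier_vec n" and \<zeta>: "\<zeta> \<in> carrier_vec n \<rightarrow> carrier_vec n"
    and x: "x \<in> carrier_vec n" and z: "z \<in> carrier_vec n"
    and eq1: "\<Omega>1 *\<^sub>v vabs x + \<Omega>1 *\<^sub>v x = \<gamma> \<cdot>\<^sub>v (z - \<zeta> z)"
    and eq2: "\<Omega>2 *\<^sub>v vabs x - \<Omega>2 *\<^sub>v x = \<gamma> \<cdot>\<^sub>v (A *\<^sub>v z + q)"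
  shows "relaxation_step n A (\<Omega>2 + M * \<Omega>1 + \<phi> * \<Omega>1) (N * \<Omega>1 + \<phi> * \<Omega>1) (\<Omega>2 - A * \<Omega>1)
    \<Omega>2 q \<zeta> \<gamma> x = x"
proof -
  let ?H = "\<Omega>2 + M * \<Omega>1 + \<phi> * \<Omega>1"
  let ?a = "vabs x"
  have A': "A \<in> carrier_mat n n" unfolding A(1) using N \<phi> by (intro minus_carrier_mat) simp
  have Hc: "?H \<in> carrier_mat n n" using M \<phi> \<Omega>1 \<Omega>2 by simp
  have a: "?a \<in> carrier_vec n" using x by simp
  have \<zeta>z: "\<zeta> z \<in> carrier_vec n" using \<zeta> z by blast
  note \<Omega>x = mult_mat_vec_carrier[OF \<Omega>1 x] and \<Omega>a = mult_mat_vec_carrier[OF \<Omega>1 a]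
  have zz: "z_of n A q \<gamma> \<Omega>2 x = z"
    by (rule modulus_z_of[OF A' A(2) \<gamma> \<Omega>2 q x z eq2])
  have 1: "A *\<^sub>v (\<Omega>1 *\<^sub>v ?a) + A *\<^sub>v (\<Omega>1 *\<^sub>v x) = \<gamma> \<cdot>\<^sub>v (A *\<^sub>v z - A *\<^sub>v \<zeta> z)"
    by (simp only: mult_add_distrib_mat_vec[OF A' \<Omega>a \<Omega>x, symmetric] eq1
        mult_mat_vec[OF A' minus_carrier_vec[OF z \<zeta>z]] mult_minus_distrib_mat_vec[OF A' z \<zeta>z])
  \<comment> \<open>Only the term in \<open>x\<close> is split; the term in \<open>vabs x\<close>
    keeps \<open>A\<close>, as it does in the coefficient
    \<open>\<Omega>2 - A * \<Omega>1\<close>.\<close>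
  have 2: "A *\<^sub>v (\<Omega>1 *\<^sub>v x) = (M *\<^sub>v (\<Omega>1 *\<^sub>v x) + \<phi> *\<^sub>v (\<Omega>1 *\<^sub>v x))
      - (N *\<^sub>v (\<Omega>1 *\<^sub>v x) + \<phi> *\<^sub>v (\<Omega>1 *\<^sub>v x))"
    by (simp only: A(1) minus_mult_distrib_mat_vec[OF add_carrier_mat[OF \<phi>] add_carrier_mat[OF \<phi>] \<Omega>x]
        add_mult_distrib_mat_vec[OF M \<phi> \<Omega>x] add_mult_distrib_mat_vec[OF N \<phi> \<Omega>x])
  have 3: "?H *\<^sub>v x = \<Omega>2 *\<^sub>v x + M *\<^sub>v (\<Omega>1 *\<^sub>v x) + \<phi> *\<^sub>v (\<Omega>1 *\<^sub>v x)"
    by (simp only: add_mult_distrib_mat_vec[OF add_carrier_mat[OF mult_carrier_mat[OF M \<Omega>1]]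
          mult_carrier_mat[OF \<phi> \<Omega>1] x]
        add_mult_distrib_mat_vec[OF \<Omega>2 mult_carrier_mat[OF M \<Omega>1] x]
        assoc_mult_mat_vec[OF M \<Omega>1 x] assoc_mult_mat_vec[OF \<phi> \<Omega>1 x])
  have 4: "(N * \<Omega>1 + \<phi> * \<Omega>1) *\<^sub>v x = N *\<^sub>v (\<Omega>1 *\<^sub>v x) + \<phi> *\<^sub>v (\<Omega>1 *\<^sub>v x)"
    by (simp only: add_mult_distrib_mat_vec[OF mult_carrier_mat[OF N \<Omega>1] mult_carrier_mat[OF \<phi> \<Omega>1] x]
        assoc_mult_mat_vec[OF N \<Omega>1 x] assoc_mult_mat_vec[OF \<phi> \<Omega>1 x])
  have 5: "(\<Omega>2 - A * \<Omega>1) *\<^sub>v ?a = \<Omega>2 *\<^sub>v ?a - A *\<^sub>v (\<Omega>1 *\<^sub>v ?a)"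
    by (simp only: minus_mult_distrib_mat_vec[OF \<Omega>2 mult_carrier_mat[OF A' \<Omega>1] a]
        assoc_mult_mat_vec[OF A' \<Omega>1 a])
  have "(N * \<Omega>1 + \<phi> * \<Omega>1) *\<^sub>v x + (\<Omega>2 - A * \<Omega>1) *\<^sub>v ?a - \<gamma> \<cdot>\<^sub>v (A *\<^sub>v \<zeta> z) - \<gamma> \<cdot>\<^sub>v q = ?H *\<^sub>v x"
    unfolding 3 4 5
  proof (rule eq_vecI)
    fix i
    assume "i < dim_vec (\<Omega>2 *\<^sub>v x + M *\<^sub>v (\<Omega>1 *\<^sub>v x) + \<phi> *\<^sub>v (\<Omega>1 *\<^sub>v x))"
    then have i: "i < n" using \<phi> by simp
    have dims: "dim_row A = n" "dim_row M = n" "dim_row N = n" "dim_row \<phi> = n" "dim_row \<Omega>1 = n"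
      "dim_row \<Omega>2 = n" "dim_vec q = n"
      using A' M N \<phi> \<Omega>1 \<Omega>2 q by auto
    \<comment> \<open>In each entry the claim is a linear combination of \<open>1\<close>,
      \<open>2\<close> and \<open>eq2\<close>. The matrix-vector products serve as atoms, so
      \<open>index_mult_mat_vec\<close> must not unfold them.\<close>
    from arg_cong[OF 1, of "\<lambda>v. v $ i"] arg_cong[OF 2, of "\<lambda>v. v $ i"] arg_cong[OF eq2, of "\<lambda>v. v $ i"]
    show "(N *\<^sub>v (\<Omega>1 *\<^sub>v x) + \<phi> *\<^sub>v (\<Omega>1 *\<^sub>v x) + (\<Omega>2 *\<^sub>v ?a - A *\<^sub>v (\<Omega>1 *\<^sub>v ?a))
        - \<gamma> \<cdot>\<^sub>v (A *\<^sub>v \<zeta> z) - \<gamma> \<cdot>\<^sub>v q) $ i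
      = (\<Omega>2 *\<^sub>v x + M *\<^sub>v (\<Omega>1 *\<^sub>v x) + \<phi> *\<^sub>v (\<Omega>1 *\<^sub>v x)) $ i"
      using i dims by (simp add: algebra_simps del: index_mult_mat_vec)
  qed (use q \<phi> in simp)
  then have "relaxation_step n A ?H (N * \<Omega>1 + \<phi> * \<Omega>1) (\<Omega>2 - A * \<Omega>1) \<Omega>2 q \<zeta> \<gamma> x
      = mat_inv ?H *\<^sub>v (?H *\<^sub>v x)"
    by (simp only: relaxation_step_def zz)
  also have "\<dots> = x"
    using assoc_mult_mat_vec[OF mat_inv_det(1)[OF Hc H] Hc x] x
    by (simp only: mat_inv_det(3)[OF Hc H] one_mult_mat_vec)
  finally show ?thesis .
qed

section \<open>Convergence of the method\<close>

text \<open>The closed form of \<open>z_of\<close> is built from linear maps, differences and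
  entrywise absolute values, all of which preserve entrywise convergence.\<close>

lemma vec_converges_z_of:
  assumes A: "A \<in> carrier_mat n n" "det A \<noteq> 0" and \<Omega>2: "\<Omega>2 \<in> carrier_mat n n"
    and q: "q \<in> carrier_vec n" and s: "vec_converges n s l"
  shows "vec_converges n (\<lambda>k. z_of n A q \<gamma> \<Omega>2 (s k)) (z_of n A q \<gamma> \<Omega>2 l)"
proof -
  have c: "l \<in> carrier_vec n" "s k \<in> carrier_vec n" for k
    using s by (auto simp: vec_converges_def)
  have "vec_converges n (\<lambda>k. ((1 / \<gamma>) \<cdot>\<^sub>m \<Omega>2) *\<^sub>v (vabs (s k) - s k) - q)
      (((1 / \<gamma>) \<cdot>\<^sub>m \<Omega>2) *\<^sub>v (vabs l - l) - q)"
    by (rule vec_converges_minus[OF vec_converges_mult_mat_vec vec_converges_const[OF q],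
          OF smult_carrier_mat[OF \<Omega>2] vec_converges_minus[OF vec_converges_vabs[OF s] s]])
  from vec_converges_mult_mat_vec[OF mat_inv_det(1)[OF A] this]
  show ?thesis
    by (simp only: z_of_eq[OF A \<Omega>2 q c(1)] z_of_eq[OF A \<Omega>2 q c(2)])
qed

theorem theorem4p1:
  fixes n :: nat
    and A M N \<phi> \<Omega>1 \<Omega>2 \<Psi> L :: "real mat"
    and q zstar :: "real vec"
    and \<zeta> :: "real vec \<Rightarrow> real vec"
    and \<gamma> :: real
  assumes "0 < n"
    and "P_matrix n A"
    and "q \<in> carrier_vec n"
    and "\<zeta> \<in> carrier_vec n \<rightarrow> carrier_vec n"
    and "\<gamma> > 0"
    and "ICP_solution n q A \<zeta> zstar"
    and "\<exists>!z. ICP_solution n q A \<zeta> z"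
    and "\<Omega>1 \<in> carrier_mat n n" and "pos_diagonal_mat \<Omega>1"
    and "\<Omega>2 \<in> carrier_mat n n" and "pos_diagonal_mat \<Omega>2"
    and "\<phi> \<in> carrier_mat n n" and "diagonal_mat \<phi>"
    and "M \<in> carrier_mat n n" and "N \<in> carrier_mat n n"
    and "A = (M + \<phi>) - (N + \<phi>)"
    and "invertible_mat (\<Omega>2 + M * \<Omega>1 + \<phi> * \<Omega>1)"
    and "\<Psi> \<in> carrier_mat n n" and "0\<^sub>m n n \<le> \<Psi>"
    and "\<forall>x\<in>carrier_vec n. \<forall>y\<in>carrier_vec n. vabs (\<zeta> x - \<zeta> y) \<le> \<Psi> *\<^sub>v vabs (x - y)"
    and "L = mabs (mat_inv (\<Omega>2 + M * \<Omega>1 + \<phi> * \<Omega>1)) *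
           (mabs (N * \<Omega>1 + \<phi> * \<Omega>1) + mabs (\<Omega>2 - A * \<Omega>1)
             + 2 \<cdot>\<^sub>m (mabs A * \<Psi> * mabs (mat_inv A) * \<Omega>2))"
    and "spectral_radius (map_mat complex_of_real L) < 1"
  shows "\<forall>x0\<in>carrier_vec n.
           vec_converges n (relaxation_z n A M N \<phi> \<Omega>1 \<Omega>2 q \<zeta> \<gamma> x0) zstar"
proof
  fix x0 :: "real vec"
  assume x0: "x0 \<in> carrier_vec n"
  let ?H = "\<Omega>2 + M * \<Omega>1 + \<phi> * \<Omega>1"
  let ?G = "N * \<Omega>1 + \<phi> * \<Omega>1"
  let ?B = "\<Omega>2 - A * \<Omega>1"
  let ?F = "relaxation_step n A ?H ?G ?B \<Omega>2 q \<zeta> \<gamma>"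
  let ?x = "relaxation_x n A M N \<phi> \<Omega>1 \<Omega>2 q \<zeta> \<gamma> x0"
  note \<Omega>1 = assms(8,9) and \<Omega>2 = assms(10,11) and \<phi> = assms(12) and M = assms(14) and N = assms(15)
    and q = assms(3) and \<zeta> = assms(4) and \<gamma> = assms(5) and \<Psi> = assms(18,19)
  have A: "A \<in> carrier_mat n n" using assms(2) by (simp add: P_matrix_def)
  have dA: "det A \<noteq> 0" by (rule P_matrix_det_nonzero[OF assms(1,2)])
  have H: "?H \<in> carrier_mat n n" and G: "?G \<in> carrier_mat n n" and B: "?B \<in> carrier_mat n n"
    using A M N \<phi> \<Omega>1(1) \<Omega>2(1) by auto
  have dH: "det ?H \<noteq> 0" by (rule invertible_mat_det_nonzero[OF H assms(17)])
  note Ai = mat_inv_det(1)[OF A dA] and Hi = mat_inv_det(1)[OF H dH]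
  \<comment> \<open>In \<open>L\<close> the matrix \<open>\<Omega>2\<close> is a factor without
    absolute value; its nonnegativity comes from the positive diagonal and the zeros
    elsewhere.\<close>
  have "0\<^sub>m n n \<le> \<Omega>2"
    using \<Omega>2 unfolding pos_diagonal_mat_def diagonal_mat_def less_eq_mat_def
    by (auto intro: less_imp_le simp: order.order_iff_strict)
  then have T: "0\<^sub>m n n \<le> mabs A * \<Psi> * mabs (mat_inv A) * \<Omega>2"
    using A Ai \<Psi> \<Omega>2(1)
    by (intro mult_mat_nonneg[of _ n n] mabs_nonneg) simp_all
  have Tc: "mabs A * \<Psi> * mabs (mat_inv A) * \<Omega>2 \<in> carrier_mat n n"
    using A Ai \<Psi> \<Omega>2(1) by (intro mult_carrier_mat[of _ n n]) simp_all
  have L: "L \<in> carrier_mat n n" "0\<^sub>m n n \<le> L"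
    unfolding assms(21) using Hi G B Tc
    by (simp, intro mult_mat_nonneg[of _ n n] add_mat_nonneg mabs_nonneg smult_mat_nonneg T) simp_all
  have zs: "zstar \<in> carrier_vec n" using assms(6) by (simp add: ICP_solution_def)
  \<comment> \<open>The limit of the \<open>x\<close> iterates is obtained from the solution
    \<open>zstar\<close>, so its existence requires no completeness argument.\<close>
  obtain xs where xs: "xs \<in> carrier_vec n"
    "\<Omega>1 *\<^sub>v vabs xs + \<Omega>1 *\<^sub>v xs = \<gamma> \<cdot>\<^sub>v (zstar - \<zeta> zstar)"
    "\<Omega>2 *\<^sub>v vabs xs - \<Omega>2 *\<^sub>v xs = \<gamma> \<cdot>\<^sub>v (A *\<^sub>v zstar + q)"
    using ICP_solution_modulus[OF assms(6) \<gamma> A q \<zeta> \<Omega>1 \<Omega>2] .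
  have "vec_converges n ?x xs"
  proof (rule contraction_vec_converges[where F = ?F, OF assms(1) L assms(22)])
    show "?F \<in> carrier_vec n \<rightarrow> carrier_vec n"
      using relaxation_step_carrier[OF H dH q] by blast
    show "vabs (?F x - ?F y) \<le> L *\<^sub>v vabs (x - y)"
      if "x \<in> carrier_vec n" "y \<in> carrier_vec n" for x y
      unfolding assms(21)
      by (rule relaxation_step_lipschitz[OF A dA \<gamma> \<Omega>2 H dH G B q \<zeta> \<Psi> assms(20) that])
    show "?F xs = xs"
      by (rule modulus_fixed_point[OF M N \<phi> assms(16) dA \<gamma> \<Omega>1(1) \<Omega>2(1) dH q \<zeta> xs(1) zs xs(2,3)])
    show "?x (Suc k) = ?F (?x k)" for k
      by (rule relaxation_x_Suc)
  qed (use x0 xs in simp_all)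
  \<comment> \<open>The second modulus equation identifies the value of \<open>z_of\<close> at
    \<open>xs\<close> as \<open>zstar\<close>, so continuity carries the limit over.\<close>
  from vec_converges_z_of[OF A dA \<Omega>2(1) q this, of \<gamma>]
  show "vec_converges n (relaxation_z n A M N \<phi> \<Omega>1 \<Omega>2 q \<zeta> \<gamma> x0) zstar"
    unfolding modulus_z_of[OF A dA \<gamma> \<Omega>2(1) q xs(1) zs xs(3)] relaxation_z_def .
qed

end
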